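(* Let $n\ge 1$, let $r_1,\dots,r_n\ge 2$ be pairwise coprime integers, let $G$ be the group presented by $\langle a_i,b_i,\ i=1,\dots,n \mid R_i,S_i,\ i=1,\dots,n\rangle$ with $R_i=a_ib_ia_i^{-1}b_i^{-1}$ and $S_i=a_i^{r_i}$ (so $G$ is the free product of the groups $C_{r_i}\times\mathbb{Z}$), and let $M$ be the relation module of this presentation, a right $\mathbb{Z}[G]$-module, with $D_i,E_i\in M$ the images of $R_i,S_i$ respectively. Set $$X_i=E_i+D_i(1-a_i),\quad i=1,\dots,n,\qquad\text{and}\qquad X_{n+1}=\sum_{i=1}^n D_i.$$ Then $X_1,\dots,X_{n+1}$ generate the whole of $M$ as a right $\mathbb{Z}[G]$-module.
   Context: Let $F$ be the free group on $a_1,b_1,\dots,a_n,b_n$ and let $N\trianglelefteq F$ be the normal closure of the elements $R_i,S_i$ ($i=1,\dots,n$), so $G=F/N$. The relation module is the abelianization $M=N/[N,N]$, written additively, with the right $\mathbb{Z}[G]$-module structure induced by conjugation in $F$: for $m\in M$ represented by $x\in N$ and $g\in G$ represented by $w\in F$, the element $m\cdot g$ is represented by $w^{-1}xw$. The symbols $a_i$, $b_i$ also denote their images in $G\subset\mathbb{Z}[G]$. $C_r$ denotes the cyclic group of order $r$. *)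

theory Defs
  imports "HOL-Algebra.Generated_Groups" "HOL-Algebra.Module" "HOL-Library.Poly_Mapping"
begin

section \<open>Free groups\<close>

text \<open>A word over \<open>X\<close> is a list of signed letters: \<open>(x, True)\<close> stands for \<open>x\<close> and
  \<open>(x, False)\<close> for its formal inverse. The free group consists of the classes of words modulo
  insertion and deletion of adjacent mutually inverse letters.\<close>

definition words :: "'x set \<Rightarrow> ('x \<times> bool) list set" where
  "words X = lists (X \<times> UNIV)"

inductive word_eq :: "'x set \<Rightarrow> ('x \<times> bool) list \<Rightarrow> ('x \<times> bool) list \<Rightarrow> bool" for X where
  refl: "w \<in> words X \<Longrightarrow> word_eq X w w"
| sym: "word_eq X u v \<Longrightarrow> word_eq X v u"
| trans: "word_eq X u v \<Longrightarrow> word_eq X v w \<Longrightarrow> word_eq X u w"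
| cancel: "u \<in> words X \<Longrightarrow> v \<in> words X \<Longrightarrow> x \<in> X \<Longrightarrow>
    word_eq X (u @ [(x, e), (x, \<not> e)] @ v) (u @ v)"

definition word_rel :: "'x set \<Rightarrow> (('x \<times> bool) list \<times> ('x \<times> bool) list) set" where
  "word_rel X = {(u, v). word_eq X u v}"

definition free_group :: "'x set \<Rightarrow> ('x \<times> bool) list set monoid" where
  "free_group X =
     \<lparr>carrier = words X // word_rel X,
      mult = (\<lambda>p q. \<Union>u\<in>p. \<Union>v\<in>q. word_rel X `` {u @ v}),
      one = word_rel X `` {[]}\<rparr>"

definition free_gen :: "'x set \<Rightarrow> 'x \<Rightarrow> ('x \<times> bool) list set" where
  "free_gen X x = word_rel X `` {[(x, True)]}"

lemma words_simps [simp]: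
  "[] \<in> words X"
  "p # w \<in> words X \<longleftrightarrow> fst p \<in> X \<and> w \<in> words X"
  "u @ v \<in> words X \<longleftrightarrow> u \<in> words X \<and> v \<in> words X"
  by (auto simp: words_def mem_Times_iff)

lemma word_eq_words:
  "word_eq X u v \<Longrightarrow> u \<in> words X \<and> v \<in> words X"
  by (induction rule: word_eq.induct) auto

lemma equiv_word_rel: "equiv (words X) (word_rel X)"
  unfolding equiv_def refl_on_def sym_def trans_def word_rel_def
  using word_eq_words by (auto intro: word_eq.intros(1,2) dest: word_eq.trans)

lemma word_eq_append_left:
  "word_eq X u v \<Longrightarrow> w \<in> words X \<Longrightarrow> word_eq X (w @ u) (w @ v)"
proof (induction rule: word_eq.induct)
  case (cancel u v x e)
  then show ?case using word_eq.cancel[of "w @ u" X v x e] by auto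
qed (auto intro: word_eq.intros)

lemma word_eq_append_right:
  "word_eq X u v \<Longrightarrow> w \<in> words X \<Longrightarrow> word_eq X (u @ w) (v @ w)"
proof (induction rule: word_eq.induct)
  case (cancel u v x e)
  then show ?case using word_eq.cancel[of u X "v @ w" x e] by auto
qed (auto intro: word_eq.intros)

lemma word_eq_append:
  assumes "word_eq X u u'" "word_eq X v v'"
  shows "word_eq X (u @ v) (u' @ v')"
  using assms word_eq_words
  by (meson word_eq.trans word_eq_append_left word_eq_append_right)

lemma word_class_eq_iff:
  assumes "u \<in> words X" "v \<in> words X"
  shows "word_rel X `` {u} = word_rel X `` {v} \<longleftrightarrow> word_eq X u v"
  using eq_equiv_class_iff[OF equiv_word_rel assms] by (simp add: word_rel_def)

lemma free_group_mult:
  assumes "u \<in> words X" "v \<in> words X"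
  shows "(word_rel X `` {u}) \<otimes>\<^bsub>free_group X\<^esub> (word_rel X `` {v}) = word_rel X `` {u @ v}"
proof -
  have "congruent2 (word_rel X) (word_rel X) (\<lambda>u v. word_rel X `` {u @ v})"
    unfolding congruent2_def
  proof (clarify)
    fix u u' v v' assume "(u, u') \<in> word_rel X" "(v, v') \<in> word_rel X"
    then have "word_eq X (u @ v) (u' @ v')" by (auto simp: word_rel_def intro: word_eq_append)
    with word_eq_words[OF this] show "word_rel X `` {u @ v} = word_rel X `` {u' @ v'}"
      by (simp add: word_class_eq_iff)
  qed
  from UN_equiv_class2[OF equiv_word_rel equiv_word_rel this assms] show ?thesis
    by (simp add: free_group_def)
qed

definition word_inv :: "('x \<times> bool) list \<Rightarrow> ('x \<times> bool) list" where
  "word_inv w = rev (map (\<lambda>(x, e). (x, \<not> e)) w)"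

lemma word_inv_words: "w \<in> words X \<Longrightarrow> word_inv w \<in> words X"
  by (auto simp: word_inv_def words_def)

lemma word_inv_cancel: "w \<in> words X \<Longrightarrow> word_eq X (word_inv w @ w) []"
proof (induction w)
  case Nil
  then show ?case by (auto simp: word_inv_def intro: word_eq.refl)
next
  case (Cons p w)
  obtain x e where p: "p = (x, e)" by force
  have w: "w \<in> words X" and x: "x \<in> X" using Cons.prems p by auto
  have "word_eq X (word_inv w @ [(x, \<not> e), (x, \<not> \<not> e)] @ w) (word_inv w @ w)"
    by (rule word_eq.cancel) (use w x word_inv_words in auto)
  then have "word_eq X (word_inv (p # w) @ p # w) (word_inv w @ w)"
    by (simp add: word_inv_def p)
  with Cons.IH[OF w] show ?case by (blast intro: word_eq.trans)
qed

lemma carrier_free_group: "carrier (free_group X) = (\<lambda>u. word_rel X `` {u}) ` words X"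
  by (auto simp: free_group_def quotient_def)

lemma one_free_group: "\<one>\<^bsub>free_group X\<^esub> = word_rel X `` {[]}"
  by (simp add: free_group_def)

lemma group_free_group: "group (free_group X)"
proof (rule groupI)
  fix p assume "p \<in> carrier (free_group X)"
  then obtain u where u: "u \<in> words X" "p = word_rel X `` {u}"
    by (auto simp: carrier_free_group)
  have "word_rel X `` {word_inv u} \<otimes>\<^bsub>free_group X\<^esub> p = word_rel X `` {word_inv u @ u}"
    using u word_inv_words[OF u(1)] by (simp add: free_group_mult)
  also have "\<dots> = word_rel X `` {[]}"
    using u word_inv_words[OF u(1)] by (subst word_class_eq_iff) (auto intro: word_inv_cancel)
  finally show "\<exists>q\<in>carrier (free_group X). q \<otimes>\<^bsub>free_group X\<^esub> p = \<one>\<^bsub>free_group X\<^esub>"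
    using word_inv_words[OF u(1)] by (auto simp: one_free_group carrier_free_group)
qed (auto simp: carrier_free_group one_free_group free_group_mult)

lemma free_gen_closed: "x \<in> X \<Longrightarrow> free_gen X x \<in> carrier (free_group X)"
  by (auto simp: free_gen_def carrier_free_group)

definition word_val :: "('g, 'b) monoid_scheme \<Rightarrow> ('x \<Rightarrow> 'g) \<Rightarrow> ('x \<times> bool) list \<Rightarrow> 'g" where
  "word_val H f w =
     foldr (\<lambda>(x, e) p. (if e then f x else inv\<^bsub>H\<^esub> f x) \<otimes>\<^bsub>H\<^esub> p) w \<one>\<^bsub>H\<^esub>"

lemma (in group) word_val_closed:
  "f \<in> X \<rightarrow> carrier G \<Longrightarrow> w \<in> words X \<Longrightarrow> word_val G f w \<in> carrier G"
  by (induction w) (auto simp: word_val_def Pi_iff)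

lemma (in group) word_val_append:
  "f \<in> X \<rightarrow> carrier G \<Longrightarrow> u \<in> words X \<Longrightarrow> v \<in> words X \<Longrightarrow>
    word_val G f (u @ v) = word_val G f u \<otimes> word_val G f v"
proof (induction u)
  case Nil
  then show ?case using word_val_closed[of f X v] by (simp add: word_val_def)
next
  case (Cons p u)
  obtain x e where p: "p = (x, e)" by force
  have x: "f x \<in> carrier G" and u: "u \<in> words X" using Cons.prems p by auto
  have "word_val G f ((p # u) @ v)
      = (if e then f x else inv f x) \<otimes> (word_val G f u \<otimes> word_val G f v)"
    using Cons u p by (simp add: word_val_def)
  also have "\<dots> = word_val G f (p # u) \<otimes> word_val G f v"
    using x word_val_closed[OF Cons.prems(1) u] word_val_closed[OF Cons.prems(1,3)]
    by (simp add: p word_val_def m_assoc)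
  finally show ?case .
qed

lemma (in group) word_val_cong:
  "word_eq X u v \<Longrightarrow> f \<in> X \<rightarrow> carrier G \<Longrightarrow> word_val G f u = word_val G f v"
proof (induction rule: word_eq.induct)
  case (cancel u v x e)
  have x: "f x \<in> carrier G" using cancel by auto
  have "word_val G f ([(x, e), (x, \<not> e)] @ v) = word_val G f v"
    using x word_val_closed[OF cancel(4,2)]
    by (cases e) (simp_all add: word_val_def flip: m_assoc)
  moreover have "[(x, e), (x, \<not> e)] @ v \<in> words X" using cancel by auto
  ultimately show ?case using cancel word_val_append by metis
qed auto

theorem (in group) free_group_universal:
  assumes f: "f \<in> X \<rightarrow> carrier G"
  shows "\<exists>!h. h \<in> extensional (carrier (free_group X)) \<and> h \<in> hom (free_group X) G \<and>
    (\<forall>x\<in>X. h (free_gen X x) = f x)"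
proof -
  let ?F = "free_group X"
  let ?c = "\<lambda>w. word_rel X `` {w}"
  interpret F: group ?F by (rule group_free_group)
  define h where "h = restrict (\<lambda>p. word_val G f (SOME w. w \<in> p)) (carrier ?F)"
  have hc: "h (?c w) = word_val G f w" if w: "w \<in> words X" for w
  proof -
    have "w \<in> ?c w" using equiv_class_self[OF equiv_word_rel w] .
    then have "(SOME w'. w' \<in> ?c w) \<in> ?c w" by (rule someI)
    then have "word_eq X w (SOME w'. w' \<in> ?c w)" by (auto simp: word_rel_def)
    from word_val_cong[OF this f] show ?thesis
      using w by (auto simp: h_def carrier_free_group)
  qed
  have hom: "h \<in> hom ?F G"
  proof (rule homI)
    fix p assume "p \<in> carrier ?F"
    then show "h p \<in> carrier G"
      using f by (auto simp: carrier_free_group hc word_val_closed)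
  next
    fix p q assume "p \<in> carrier ?F" "q \<in> carrier ?F"
    then obtain u v where "u \<in> words X" "v \<in> words X" "p = ?c u" "q = ?c v"
      by (auto simp: carrier_free_group)
    then show "h (p \<otimes>\<^bsub>?F\<^esub> q) = h p \<otimes> h q"
      using f by (simp add: free_group_mult hc word_val_append)
  qed
  have gen: "\<forall>x\<in>X. h (free_gen X x) = f x"
    using f by (auto simp: free_gen_def hc word_val_def Pi_iff)
  have uniq: "k (?c w) = word_val G f w"
    if k: "k \<in> hom ?F G" "\<forall>x\<in>X. k (free_gen X x) = f x" and "w \<in> words X" for k w
    using that(3)
  proof (induction w)
    case Nil
    have "k \<one>\<^bsub>?F\<^esub> = \<one>" using k(1) F.group_axioms group_axioms
      by (simp add: hom_one)
    then show ?case by (simp add: one_free_group word_val_def)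
  next
    case (Cons p w)
    obtain x e where p: "p = (x, e)" by force
    have x: "x \<in> X" and w: "w \<in> words X" using Cons.prems p by auto
    have t: "?c [(x, True)] \<in> carrier ?F" and t': "?c [(x, False)] \<in> carrier ?F"
      and cw: "?c w \<in> carrier ?F"
      using x w by (auto simp: carrier_free_group)
    have "word_eq X ([] @ [(x, False), (x, \<not> False)] @ []) ([] @ [])"
      by (rule word_eq.cancel) (use x in auto)
    then have "?c [(x, False)] \<otimes>\<^bsub>?F\<^esub> ?c [(x, True)] = \<one>\<^bsub>?F\<^esub>"
      using x by (simp add: free_group_mult one_free_group word_class_eq_iff)
    then have inv: "?c [(x, False)] = inv\<^bsub>?F\<^esub> ?c [(x, True)]"
      using t t' by (metis F.inv_equality)
    interpret K: group_hom ?F G k by unfold_locales (rule k(1))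
    have "k (?c [p]) = (if e then f x else inv f x)"
      using k(2) x t by (cases e) (simp_all add: p inv free_gen_def)
    moreover have "?c (p # w) = ?c [p] \<otimes>\<^bsub>?F\<^esub> ?c w"
      using x w p by (subst free_group_mult) auto
    moreover have "?c [p] \<in> carrier ?F" using t t' p by (cases e) auto
    ultimately show ?case
      using Cons.IH[OF w] cw by (simp add: word_val_def p)
  qed
  show ?thesis
  proof (rule ex1I[of _ h], use hom gen h_def in simp)
    fix k assume k: "k \<in> extensional (carrier ?F) \<and> k \<in> hom ?F G \<and>
      (\<forall>x\<in>X. k (free_gen X x) = f x)"
    show "k = h"
    proof (rule extensionalityI)
      fix p assume "p \<in> carrier ?F"
      then show "k p = h p" using uniq k hc by (auto simp: carrier_free_group)
    qed (use k h_def in auto)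
  qed
qed


section \<open>Presentations\<close>

definition normal_closure :: "('a, 'b) monoid_scheme \<Rightarrow> 'a set \<Rightarrow> 'a set" where
  "normal_closure G R = \<Inter>{N. N \<lhd> G \<and> R \<subseteq> N}"

lemma (in group) normal_closure_normal:
  assumes "R \<subseteq> carrier G"
  shows "normal_closure G R \<lhd> G"
proof -
  have ne: "carrier G \<in> {N. N \<lhd> G \<and> R \<subseteq> N}" using assms normal_self by simp
  have "subgroup (normal_closure G R) G"
    unfolding normal_closure_def
    using ne by (intro subgroups_Inter) (auto dest: normal_imp_subgroup)
  moreover have "x \<otimes> h \<otimes> inv x \<in> normal_closure G R"
    if "x \<in> carrier G" "h \<in> normal_closure G R" for x h
    using that by (auto simp: normal_closure_def normal_inv_iff)
  ultimately show ?thesis by (simp add: normal_inv_iff)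
qed


section \<open>Integral group rings\<close>

text \<open>An element of \<open>\<int>[G]\<close> is a finitely supported integer-valued function with support in
  the carrier of \<open>G\<close>; the element \<open>g\<close> of \<open>G\<close> is embedded as \<open>frag_of g\<close>.\<close>

definition group_ring :: "('g, 'b) monoid_scheme \<Rightarrow> ('g \<Rightarrow>\<^sub>0 int) ring" where
  "group_ring G =
     \<lparr>carrier = {c. Poly_Mapping.keys c \<subseteq> carrier G},
      mult = (\<lambda>c d. frag_extend (\<lambda>g. frag_extend (\<lambda>h. frag_of (g \<otimes>\<^bsub>G\<^esub> h)) d) c),
      one = frag_of \<one>\<^bsub>G\<^esub>,
      zero = 0,
      add = (+)\<rparr>"

lemma group_ring_simps:
  "carrier (group_ring G) = {c. Poly_Mapping.keys c \<subseteq> carrier G}"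
  "\<one>\<^bsub>group_ring G\<^esub> = frag_of \<one>\<^bsub>G\<^esub>"
  "\<zero>\<^bsub>group_ring G\<^esub> = 0"
  "c \<oplus>\<^bsub>group_ring G\<^esub> d = c + d"
  "c \<otimes>\<^bsub>group_ring G\<^esub> d
    = frag_extend (\<lambda>g. frag_extend (\<lambda>h. frag_of (g \<otimes>\<^bsub>G\<^esub> h)) d) c"
  by (simp_all add: group_ring_def)

lemma frag_cmul_diff_r: "frag_cmul k (x - y) = frag_cmul k x - frag_cmul k y"
  by (rule poly_mapping_eqI) (simp add: lookup_minus right_diff_distrib)

lemma frag_extend_fun_diff:
  "frag_extend (\<lambda>x. f x - g x) c = frag_extend f c - frag_extend g c"
  by (simp add: frag_extend_def sum_subtractf frag_cmul_diff_r)

lemma frag_extend_fun_0: "frag_extend (\<lambda>x. 0) c = 0"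
  by (simp add: frag_extend_def)

lemma (in monoid) group_ring_mult_closed:
  assumes "c \<in> carrier (group_ring G)" "d \<in> carrier (group_ring G)"
  shows "c \<otimes>\<^bsub>group_ring G\<^esub> d \<in> carrier (group_ring G)"
proof -
  have 1: "Poly_Mapping.keys (frag_extend (\<lambda>h. frag_of (g \<otimes> h)) d) \<subseteq> carrier G"
    if "g \<in> carrier G" for g
    by (rule order.trans[OF keys_frag_extend]) (use assms that in \<open>auto simp: group_ring_simps\<close>)
  have "Poly_Mapping.keys (c \<otimes>\<^bsub>group_ring G\<^esub> d) \<subseteq> carrier G"
    unfolding group_ring_simps
    by (rule order.trans[OF keys_frag_extend], rule UN_least, rule 1)
      (use assms in \<open>auto simp: group_ring_simps\<close>)
  then show ?thesis by (simp add: group_ring_simps(1))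
qed

lemma group_ring_diff_l:
  "(c - c') \<otimes>\<^bsub>group_ring G\<^esub> d = c \<otimes>\<^bsub>group_ring G\<^esub> d - c' \<otimes>\<^bsub>group_ring G\<^esub> d"
  by (simp add: group_ring_simps frag_extend_diff)

lemma group_ring_diff_r:
  "d \<otimes>\<^bsub>group_ring G\<^esub> (c - c') = d \<otimes>\<^bsub>group_ring G\<^esub> c - d \<otimes>\<^bsub>group_ring G\<^esub> c'"
  by (simp add: group_ring_simps frag_extend_diff frag_extend_fun_diff)

lemma group_ring_0: "0 \<otimes>\<^bsub>group_ring G\<^esub> d = 0" "d \<otimes>\<^bsub>group_ring G\<^esub> 0 = 0"
  by (simp_all add: group_ring_simps frag_extend_fun_0)

lemma group_ring_of: "frag_of g \<otimes>\<^bsub>group_ring G\<^esub> frag_of h = frag_of (g \<otimes>\<^bsub>G\<^esub> h)"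
  by (simp add: group_ring_simps)

lemma (in monoid) ring_group_ring: "ring (group_ring G)"
proof (rule ringI)
  let ?R = "group_ring G"
  show "abelian_group ?R"
  proof (rule abelian_groupI)
    fix x assume "x \<in> carrier ?R"
    then show "\<exists>y\<in>carrier ?R. y \<oplus>\<^bsub>?R\<^esub> x = \<zero>\<^bsub>?R\<^esub>"
      by (intro bexI[of _ "- x"]) (auto simp: group_ring_simps)
  next
    fix x y assume "x \<in> carrier ?R" "y \<in> carrier ?R"
    then show "x \<oplus>\<^bsub>?R\<^esub> y \<in> carrier ?R"
      using keys_add[of x y] by (auto simp: group_ring_simps)
  qed (simp_all add: group_ring_simps algebra_simps)
  show "monoid ?R"
  proof (rule monoidI)
    fix x y assume "x \<in> carrier ?R" "y \<in> carrier ?R"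
    then show "x \<otimes>\<^bsub>?R\<^esub> y \<in> carrier ?R" by (rule group_ring_mult_closed)
  next
    show "\<one>\<^bsub>?R\<^esub> \<in> carrier ?R" by (simp add: group_ring_simps)
  next
    fix x assume "x \<in> carrier ?R"
    then have x: "Poly_Mapping.keys x \<subseteq> carrier G" by (simp add: group_ring_simps)
    then show "\<one>\<^bsub>?R\<^esub> \<otimes>\<^bsub>?R\<^esub> x = x"
      by (induction x rule: frag_induction)
        (simp_all add: group_ring_0 group_ring_diff_r, simp add: group_ring_simps)
    from x show "x \<otimes>\<^bsub>?R\<^esub> \<one>\<^bsub>?R\<^esub> = x"
      by (induction x rule: frag_induction)
        (simp_all add: group_ring_0 group_ring_diff_l, simp add: group_ring_simps)
  next
    fix x y z assume "x \<in> carrier ?R" "y \<in> carrier ?R" "z \<in> carrier ?R"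
    then have x: "Poly_Mapping.keys x \<subseteq> carrier G" and y: "Poly_Mapping.keys y \<subseteq> carrier G"
      and z: "Poly_Mapping.keys z \<subseteq> carrier G" by (simp_all add: group_ring_simps)
    from x show "x \<otimes>\<^bsub>?R\<^esub> y \<otimes>\<^bsub>?R\<^esub> z = x \<otimes>\<^bsub>?R\<^esub> (y \<otimes>\<^bsub>?R\<^esub> z)"
    proof (induction x rule: frag_induction)
      case (one a)
      from y show ?case
      proof (induction y rule: frag_induction)
        case (one b)
        from z show ?case
          by (induction z rule: frag_induction)
            (use \<open>a \<in> carrier G\<close> one in
              \<open>simp_all add: group_ring_0 group_ring_diff_r group_ring_of m_assoc\<close>)
      qed (simp_all add: group_ring_0 group_ring_diff_l group_ring_diff_r)
    qed (simp_all add: group_ring_0 group_ring_diff_l)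
  qed
next
  fix x y z
  show "(x \<oplus>\<^bsub>group_ring G\<^esub> y) \<otimes>\<^bsub>group_ring G\<^esub> z
      = x \<otimes>\<^bsub>group_ring G\<^esub> z \<oplus>\<^bsub>group_ring G\<^esub> y \<otimes>\<^bsub>group_ring G\<^esub> z"
    by (simp add: group_ring_simps frag_extend_add)
  show "z \<otimes>\<^bsub>group_ring G\<^esub> (x \<oplus>\<^bsub>group_ring G\<^esub> y)
      = z \<otimes>\<^bsub>group_ring G\<^esub> x \<oplus>\<^bsub>group_ring G\<^esub> z \<otimes>\<^bsub>group_ring G\<^esub> y"
    using group_ring_diff_r[of G z x "- y"] group_ring_diff_r[of G z 0 y]
    by (simp add: group_ring_0) (simp add: group_ring_simps)
qed


section \<open>Right modules\<close>

text \<open>The locale \<^locale>\<open>module\<close> is restricted to left modules over commutative rings.\<close>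

record ('r, 'm) right_module = "'m ring" +
  rsmult :: "'m \<Rightarrow> 'r \<Rightarrow> 'm" (infixl \<open>\<triangleleft>\<index>\<close> 70)

locale right_module = R?: ring R + M?: abelian_group M for R (structure) and M (structure) +
  assumes rsmult_closed:
      "\<lbrakk>x \<in> carrier M; c \<in> carrier R\<rbrakk> \<Longrightarrow> x \<triangleleft>\<^bsub>M\<^esub> c \<in> carrier M"
    and rsmult_r_distr:
      "\<lbrakk>x \<in> carrier M; c \<in> carrier R; d \<in> carrier R\<rbrakk> \<Longrightarrow>
        x \<triangleleft>\<^bsub>M\<^esub> (c \<oplus>\<^bsub>R\<^esub> d) = x \<triangleleft>\<^bsub>M\<^esub> c \<oplus>\<^bsub>M\<^esub> x \<triangleleft>\<^bsub>M\<^esub> d"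
    and rsmult_l_distr:
      "\<lbrakk>x \<in> carrier M; y \<in> carrier M; c \<in> carrier R\<rbrakk> \<Longrightarrow>
        (x \<oplus>\<^bsub>M\<^esub> y) \<triangleleft>\<^bsub>M\<^esub> c = x \<triangleleft>\<^bsub>M\<^esub> c \<oplus>\<^bsub>M\<^esub> y \<triangleleft>\<^bsub>M\<^esub> c"
    and rsmult_assoc:
      "\<lbrakk>x \<in> carrier M; c \<in> carrier R; d \<in> carrier R\<rbrakk> \<Longrightarrow>
        x \<triangleleft>\<^bsub>M\<^esub> (c \<otimes>\<^bsub>R\<^esub> d) = x \<triangleleft>\<^bsub>M\<^esub> c \<triangleleft>\<^bsub>M\<^esub> d"
    and rsmult_one:
      "x \<in> carrier M \<Longrightarrow> x \<triangleleft>\<^bsub>M\<^esub> \<one>\<^bsub>R\<^esub> = x"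

definition right_submodule ::
    "'m set \<Rightarrow> ('r, 'b) ring_scheme \<Rightarrow> ('r, 'm, 'c) right_module_scheme \<Rightarrow> bool" where
  "right_submodule H R M \<longleftrightarrow>
     subgroup H (add_monoid M) \<and> (\<forall>x\<in>H. \<forall>c\<in>carrier R. x \<triangleleft>\<^bsub>M\<^esub> c \<in> H)"

definition right_span ::
    "('r, 'b) ring_scheme \<Rightarrow> ('r, 'm, 'c) right_module_scheme \<Rightarrow> 'm set \<Rightarrow> 'm set" where
  "right_span R M S = \<Inter>{H. right_submodule H R M \<and> S \<subseteq> H}"


section \<open>Relation modules\<close>

text \<open>For \<open>N \<lhd> F\<close>, elements of \<open>M = N/[N,N]\<close> and of \<open>G = F/N\<close> are cosets. The action of \<open>g\<close> on
  \<open>m\<close> collects the cosets of \<open>w\<^sup>-\<^sup>1xw\<close> over all representatives \<open>x\<close> of \<open>m\<close> and \<open>w\<close> of \<open>g\<close>; these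
  cosets all coincide, see \<open>conj_act_coset\<close> below.\<close>

definition conj_act :: "('a, 'b) monoid_scheme \<Rightarrow> 'a set \<Rightarrow> 'a set \<Rightarrow> 'a set \<Rightarrow> 'a set" where
  "conj_act F N m g =
     (\<Union>x\<in>m. \<Union>w\<in>g. derived F N #>\<^bsub>F\<^esub> (inv\<^bsub>F\<^esub> w \<otimes>\<^bsub>F\<^esub> x \<otimes>\<^bsub>F\<^esub> w))"

text \<open>The additive fields of \<^typ>\<open>'a ring\<close> carry the group \<open>N/[N,N]\<close>; its multiplicative fields
  are not used.\<close>

definition relation_group :: "('a, 'b) monoid_scheme \<Rightarrow> 'a set \<Rightarrow> 'a set ring" where
  "relation_group F N =
     (let A = F\<lparr>carrier := N\<rparr> Mod derived F N in
      \<lparr>carrier = carrier A, mult = undefined, one = undefined, zero = \<one>\<^bsub>A\<^esub>, add = mult A\<rparr>)"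

definition lin_ext :: "('a, 'b) ring_scheme \<Rightarrow> ('g \<Rightarrow> 'a) \<Rightarrow> ('g \<Rightarrow>\<^sub>0 int) \<Rightarrow> 'a" where
  "lin_ext A f c =
     (\<Oplus>\<^bsub>A\<^esub>g\<in>Poly_Mapping.keys c. [Poly_Mapping.lookup c g] \<cdot>\<^bsub>A\<^esub> f g)"

definition relation_module ::
    "('a, 'b) monoid_scheme \<Rightarrow> 'a set \<Rightarrow> ('a set \<Rightarrow>\<^sub>0 int, 'a set) right_module" where
  "relation_module F N =
     (let A = relation_group F N in
      \<lparr>carrier = carrier A, mult = mult A, one = one A, zero = zero A, add = add A,
       rsmult = (\<lambda>m. lin_ext A (conj_act F N m))\<rparr>)"

context abelian_group
begin

lemma lin_ext_superset:
  assumes "finite K" "Poly_Mapping.keys c \<subseteq> K" "f \<in> K \<rightarrow> carrier G"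
  shows "lin_ext G f c = (\<Oplus>g\<in>K. [Poly_Mapping.lookup c g] \<cdot> f g)"
proof -
  have "[(0::int)] \<cdot> x = \<zero>" for x by (simp add: add_pow_def)
  then show ?thesis
    unfolding lin_ext_def
    by (intro add.finprod_mono_neutral_cong_left)
      (use assms in \<open>auto simp: in_keys_iff Pi_iff\<close>)
qed

lemma lin_ext_closed:
  "f \<in> S \<rightarrow> carrier G \<Longrightarrow> Poly_Mapping.keys c \<subseteq> S \<Longrightarrow> lin_ext G f c \<in> carrier G"
  unfolding lin_ext_def by (rule finsum_closed) auto

lemma lin_ext_add:
  assumes f: "f \<in> S \<rightarrow> carrier G"
    and c: "Poly_Mapping.keys c \<subseteq> S" and d: "Poly_Mapping.keys d \<subseteq> S"
  shows "lin_ext G f (c + d) = lin_ext G f c \<oplus> lin_ext G f d"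
proof -
  let ?K = "Poly_Mapping.keys c \<union> Poly_Mapping.keys d"
  have fK: "f \<in> ?K \<rightarrow> carrier G" using f c d by auto
  have "lin_ext G f (c + d) = (\<Oplus>g\<in>?K. [Poly_Mapping.lookup (c + d) g] \<cdot> f g)"
    by (rule lin_ext_superset) (use fK keys_add[of c d] in auto)
  also have "\<dots> = (\<Oplus>g\<in>?K. [Poly_Mapping.lookup c g] \<cdot> f g \<oplus> [Poly_Mapping.lookup d g] \<cdot> f g)"
    by (rule finsum_cong') (use fK in \<open>auto simp: lookup_add add.int_pow_mult Pi_iff\<close>)
  also have "\<dots> = (\<Oplus>g\<in>?K. [Poly_Mapping.lookup c g] \<cdot> f g)
      \<oplus> (\<Oplus>g\<in>?K. [Poly_Mapping.lookup d g] \<cdot> f g)"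
    by (rule finsum_addf) (use fK in auto)
  also have "(\<Oplus>g\<in>?K. [Poly_Mapping.lookup c g] \<cdot> f g) = lin_ext G f c"
    by (rule lin_ext_superset[symmetric]) (use fK in auto)
  also have "(\<Oplus>g\<in>?K. [Poly_Mapping.lookup d g] \<cdot> f g) = lin_ext G f d"
    by (rule lin_ext_superset[symmetric]) (use fK in auto)
  finally show ?thesis .
qed

lemma lin_ext_0: "lin_ext G f 0 = \<zero>"
  by (simp add: lin_ext_def)

lemma lin_ext_of: "f g \<in> carrier G \<Longrightarrow> lin_ext G f (frag_of g) = f g"
  by (simp add: lin_ext_def keys_frag_of Pi_iff)

lemma lin_ext_fun_add:
  assumes "f \<in> S \<rightarrow> carrier G" "f' \<in> S \<rightarrow> carrier G" "Poly_Mapping.keys c \<subseteq> S"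
    and "\<And>g. g \<in> S \<Longrightarrow> h g = f g \<oplus> f' g"
  shows "lin_ext G h c = lin_ext G f c \<oplus> lin_ext G f' c"
proof -
  have "lin_ext G h c
      = (\<Oplus>g\<in>Poly_Mapping.keys c. [Poly_Mapping.lookup c g] \<cdot> f g \<oplus> [Poly_Mapping.lookup c g] \<cdot> f' g)"
    unfolding lin_ext_def
    by (rule finsum_cong') (use assms in \<open>auto simp: add.int_pow_distrib Pi_iff subset_iff\<close>)
  also have "\<dots> = lin_ext G f c \<oplus> lin_ext G f' c"
    unfolding lin_ext_def by (rule finsum_addf) (use assms in auto)
  finally show ?thesis .
qed

lemma diff_eqI: "\<lbrakk>a \<in> carrier G; b \<in> carrier G; d \<in> carrier G; a = b \<oplus> d\<rbrakk> \<Longrightarrow> b = a \<ominus> d"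
  by (simp add: a_minus_def a_assoc r_neg)

lemma lin_ext_diff:
  assumes f: "f \<in> S \<rightarrow> carrier G"
    and c: "Poly_Mapping.keys c \<subseteq> S" and d: "Poly_Mapping.keys d \<subseteq> S"
  shows "lin_ext G f (c - d) = lin_ext G f c \<ominus> lin_ext G f d"
proof -
  have cd: "Poly_Mapping.keys (c - d) \<subseteq> S" using keys_diff[of c d] c d by auto
  show ?thesis
    by (rule diff_eqI) (use lin_ext_add[OF f cd d] lin_ext_closed[OF f] c d cd in auto)
qed

end

text \<open>A \<open>\<int>\<close>-linear action of a group extends to a module structure over the group ring.\<close>

lemma right_module_group_ring:
  fixes M (structure)
  assumes G: "group G" and M: "abelian_group M"
    and closed: "\<And>x g. x \<in> carrier M \<Longrightarrow> g \<in> carrier G \<Longrightarrow> act x g \<in> carrier M"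
    and add: "\<And>x y g. x \<in> carrier M \<Longrightarrow> y \<in> carrier M \<Longrightarrow> g \<in> carrier G \<Longrightarrow>
      act (x \<oplus> y) g = act x g \<oplus> act y g"
    and one: "\<And>x. x \<in> carrier M \<Longrightarrow> act x \<one>\<^bsub>G\<^esub> = x"
    and mult: "\<And>x g h. x \<in> carrier M \<Longrightarrow> g \<in> carrier G \<Longrightarrow> h \<in> carrier G \<Longrightarrow>
      act x (g \<otimes>\<^bsub>G\<^esub> h) = act (act x g) h"
    and rsm: "\<And>x c. x \<in> carrier M \<Longrightarrow> Poly_Mapping.keys c \<subseteq> carrier G \<Longrightarrow>
      x \<triangleleft> c = lin_ext M (act x) c"
  shows "right_module (group_ring G) M"
proof -
  interpret G: group G by (rule G)
  interpret R: ring "group_ring G" by (rule G.ring_group_ring)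
  interpret M: abelian_group M by (rule M)
  have f: "act x \<in> carrier G \<rightarrow> carrier M" if "x \<in> carrier M" for x using closed that by auto
  have cl: "x \<triangleleft> c \<in> carrier M" if "x \<in> carrier M" "Poly_Mapping.keys c \<subseteq> carrier G" for x c
    using M.lin_ext_closed[OF f] that by (simp add: rsm)
  have cdiff: "Poly_Mapping.keys (c - d) \<subseteq> S"
    if "Poly_Mapping.keys c \<subseteq> S" "Poly_Mapping.keys d \<subseteq> S" for c d :: "'a \<Rightarrow>\<^sub>0 int" and S
    using keys_diff[of c d] that by auto
  have l: "(x \<oplus> y) \<triangleleft> c = x \<triangleleft> c \<oplus> y \<triangleleft> c"
    if "x \<in> carrier M" "y \<in> carrier M" "Poly_Mapping.keys c \<subseteq> carrier G" for x y c
    using that M.lin_ext_fun_add[OF f f, of x y c "act (x \<oplus> y)"] add by (simp add: rsm)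
  have ldiff: "(x \<ominus> y) \<triangleleft> c = x \<triangleleft> c \<ominus> y \<triangleleft> c"
    if "x \<in> carrier M" "y \<in> carrier M" "Poly_Mapping.keys c \<subseteq> carrier G" for x y c
  proof (rule M.diff_eqI)
    have "x = (x \<ominus> y) \<oplus> y" using that by (simp add: a_minus_def M.a_assoc M.l_neg)
    then show "x \<triangleleft> c = (x \<ominus> y) \<triangleleft> c \<oplus> y \<triangleleft> c"
      using l[of "x \<ominus> y" y c] that by simp
  qed (use that cl in auto)
  have rdiff: "x \<triangleleft> (c - d) = x \<triangleleft> c \<ominus> x \<triangleleft> d"
    if "x \<in> carrier M" "Poly_Mapping.keys c \<subseteq> carrier G" "Poly_Mapping.keys d \<subseteq> carrier G"
    for x c d
    using that cdiff by (simp add: rsm M.lin_ext_diff[OF f])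
  have zl: "\<zero> \<triangleleft> c = \<zero>" if "Poly_Mapping.keys c \<subseteq> carrier G" for c
    using ldiff[of "\<zero>" "\<zero>" c] that cl[of "\<zero>" c] by (simp add: a_minus_def M.r_neg)
  have zr: "x \<triangleleft> 0 = \<zero>" if "x \<in> carrier M" for x
    using that by (simp add: rsm M.lin_ext_0)
  have of: "x \<triangleleft> frag_of g = act x g" if "x \<in> carrier M" "g \<in> carrier G" for x g
    using that closed by (simp add: rsm M.lin_ext_of keys_frag_of)
  have mcl: "Poly_Mapping.keys (c \<otimes>\<^bsub>group_ring G\<^esub> d) \<subseteq> carrier G"
    if "Poly_Mapping.keys c \<subseteq> carrier G" "Poly_Mapping.keys d \<subseteq> carrier G" for c d
    using G.group_ring_mult_closed that by (simp add: group_ring_simps(1))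
  have assoc1: "x \<triangleleft> (frag_of g \<otimes>\<^bsub>group_ring G\<^esub> d) = act x g \<triangleleft> d"
    if x: "x \<in> carrier M" and g: "g \<in> carrier G" and d: "Poly_Mapping.keys d \<subseteq> carrier G" for x g d
  proof -
    have k: "Poly_Mapping.keys (frag_of g) \<subseteq> carrier G" using g by simp
    have "Poly_Mapping.keys d \<subseteq> carrier G \<and>
        x \<triangleleft> (frag_of g \<otimes>\<^bsub>group_ring G\<^esub> d) = act x g \<triangleleft> d"
      using d
    proof (induction d rule: frag_induction)
      case zero
      then show ?case using x closed g by (simp add: group_ring_0 zr)
    next
      case (one h)
      then show ?case using x g closed by (simp add: group_ring_of of mult)
    next
      case (diff a b)
      then show ?case using x g closed cdiff mcl[OF k]
        by (simp add: group_ring_diff_r rdiff)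
    qed
    then show ?thesis by simp
  qed
  have assoc: "x \<triangleleft> (c \<otimes>\<^bsub>group_ring G\<^esub> d) = x \<triangleleft> c \<triangleleft> d"
    if x: "x \<in> carrier M" and c: "Poly_Mapping.keys c \<subseteq> carrier G"
      and d: "Poly_Mapping.keys d \<subseteq> carrier G" for x c d
  proof -
    have "Poly_Mapping.keys c \<subseteq> carrier G \<and>
        x \<triangleleft> (c \<otimes>\<^bsub>group_ring G\<^esub> d) = x \<triangleleft> c \<triangleleft> d"
      using c
    proof (induction c rule: frag_induction)
      case zero
      then show ?case using x d by (simp add: group_ring_0 zr zl)
    next
      case (one h)
      then show ?case using x d by (simp add: assoc1 of)
    next
      case (diff a b)
      then show ?case using x d cdiff mcl cl
        by (simp add: group_ring_diff_l rdiff ldiff)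
    qed
    then show ?thesis by simp
  qed
  show ?thesis
  proof (unfold_locales, goal_cases)
    case (2 x c d)
    then show ?case using M.lin_ext_add[OF f, of x c d] keys_add[of c d]
      by (simp add: group_ring_simps rsm order.trans[OF keys_add])
  qed (use cl l assoc in \<open>simp_all add: group_ring_simps(1)\<close>, simp add: group_ring_simps of one)
qed

lemma carrier_relation_group: "carrier (relation_group F N) = (\<lambda>x. derived F N #>\<^bsub>F\<^esub> x) ` N"
  by (auto simp: relation_group_def Let_def FactGroup_def RCOSETS_def r_coset_def)

lemma zero_relation_group: "\<zero>\<^bsub>relation_group F N\<^esub> = derived F N"
  by (simp add: relation_group_def Let_def)

lemma add_relation_group: "p \<oplus>\<^bsub>relation_group F N\<^esub> q = p <#>\<^bsub>F\<^esub> q"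
  by (simp add: relation_group_def Let_def set_mult_def)

lemma relation_module_simps:
  "carrier (relation_module F N) = carrier (relation_group F N)"
  "add (relation_module F N) = add (relation_group F N)"
  "zero (relation_module F N) = zero (relation_group F N)"
  "rsmult (relation_module F N) = (\<lambda>m. lin_ext (relation_group F N) (conj_act F N m))"
  by (simp_all add: relation_module_def Let_def)

lemma lin_ext_relation_module:
  "lin_ext (relation_group F N) = (lin_ext (relation_module F N) :: ('g \<Rightarrow> _) \<Rightarrow> _)"
proof -
  have inv: "m_inv (add_monoid (relation_group F N)) = m_inv (add_monoid (relation_module F N))"
    by (intro ext) (simp add: m_inv_def relation_module_simps)
  have "add_pow (relation_group F N) = (add_pow (relation_module F N) :: int \<Rightarrow> _)"
    unfolding add_pow_def int_pow_def nat_pow_def relation_module_simps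
      inv[unfolded relation_module_simps] by (simp only: monoid.simps)
  moreover have "finsum (relation_group F N) = (finsum (relation_module F N) :: ('g \<Rightarrow> _) \<Rightarrow> _)"
    unfolding finsum_def finprod_def relation_module_simps
    by (simp only: monoid.simps partial_object.simps)
  ultimately show ?thesis by (intro ext) (simp add: lin_ext_def)
qed

context
  fixes F :: "('a, 'b) monoid_scheme" (structure) and N :: "'a set"
  assumes N: "N \<lhd> F"
begin

interpretation N: normal N F by (rule N)
interpretation D: normal "derived F N" F by (rule N.derived_is_normal[OF N])
interpretation Q: group "F Mod derived F N" by (rule D.factorgroup_is_group)

lemma der_coset_mult:
  "x \<in> carrier F \<Longrightarrow> y \<in> carrier F \<Longrightarrow> (derived F N #> x) <#> (derived F N #> y) = derived F N #> (x \<otimes> y)"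
  by (rule D.rcos_sum)

lemma der_coset_comm:
  assumes x: "x \<in> N" and y: "y \<in> N"
  shows "derived F N #> (x \<otimes> y) = derived F N #> (y \<otimes> x)"
proof -
  have [simp]: "x \<in> carrier F" "y \<in> carrier F" using x y N.subset by auto
  have "x \<otimes> y \<otimes> inv x \<otimes> inv y \<in> derived F N"
    unfolding derived_def by (rule generate.incl) (use x y in blast)
  then have "derived F N #> (x \<otimes> y \<otimes> inv x \<otimes> inv y) = derived F N"
    by (intro N.coset_join2 D.is_subgroup) auto
  then have "derived F N #> (x \<otimes> y \<otimes> inv x \<otimes> inv y \<otimes> (y \<otimes> x)) = derived F N #> (y \<otimes> x)"
    by (metis \<open>x \<in> carrier F\<close> \<open>y \<in> carrier F\<close> N.coset_mult_assoc D.subset N.inv_closed N.m_closed)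
  moreover have "x \<otimes> y \<otimes> inv x \<otimes> inv y \<otimes> (y \<otimes> x) = x \<otimes> y"
    by (simp add: N.m_assoc) (simp flip: N.m_assoc)
  ultimately show ?thesis by simp
qed

lemma conj_act_coset:
  assumes x: "x \<in> N" and w: "w \<in> carrier F"
  shows "conj_act F N (derived F N #> x) (N #> w) = derived F N #> (inv w \<otimes> x \<otimes> w)"
proof -
  note der_coset_mult[symmetric, simp]
  have [simp]: "x \<in> carrier F" using x N.subset by auto
  have "derived F N #> (inv w' \<otimes> x' \<otimes> w') = derived F N #> (inv w \<otimes> x \<otimes> w)"
    if x': "x' \<in> derived F N #> x" and w': "w' \<in> N #> w" for x' w'
  proof -
    obtain k where k: "k \<in> N" "w' = k \<otimes> w" using w' by (auto simp: r_coset_def)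
    have [simp]: "k \<in> carrier F" using k N.subset by auto
    have xc: "x' \<in> carrier F" using x' D.subset N.r_coset_subset_G[of "derived F N" x] by auto
    have "derived F N #> x' = derived F N #> x"
      using N.repr_independence[OF x' _ D.is_subgroup] by simp
    then have "derived F N #> (inv w' \<otimes> x' \<otimes> w') = derived F N #> (inv w' \<otimes> x \<otimes> w')"
      using xc w k by simp
    also have "inv w' \<otimes> x \<otimes> w' = inv w \<otimes> (inv k \<otimes> (x \<otimes> k)) \<otimes> w"
      using w k(2) by (simp add: N.inv_mult_group N.m_assoc)
    also have "derived F N #> \<dots> = (derived F N #> inv w) 
        <#> ((derived F N #> inv k) <#> (derived F N #> (x \<otimes> k))) <#> (derived F N #> w)"
      using w by (simp del: der_coset_mult[symmetric] add: der_coset_mult)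
    also have "derived F N #> (x \<otimes> k) = derived F N #> (k \<otimes> x)"
      by (rule der_coset_comm) (use x k in auto)
    also have "(derived F N #> inv w) <#> ((derived F N #> inv k) <#> (derived F N #> (k \<otimes> x))) <#> (derived F N #> w)
        = derived F N #> (inv w \<otimes> (inv k \<otimes> (k \<otimes> x)) \<otimes> w)"
      using w by (simp del: der_coset_mult[symmetric] add: der_coset_mult)
    also have "inv k \<otimes> (k \<otimes> x) = x" by (simp flip: N.m_assoc)
    finally show ?thesis .
  qed
  moreover have "x \<in> derived F N #> x" using N.rcos_self[OF _ D.is_subgroup] by simp
  moreover have "w \<in> N #> w" using N.rcos_self[OF _ N.is_subgroup] w by simp
  ultimately show ?thesis unfolding conj_act_def by blast
qed

lemma conj_closed: "x \<in> N \<Longrightarrow> w \<in> carrier F \<Longrightarrow> inv w \<otimes> x \<otimes> w \<in> N"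
  by (rule N.inv_op_closed1)

lemma abelian_group_aux:
  fixes A :: "('a set, 'c) ring_scheme"
  assumes "carrier A = carrier (relation_group F N)" "add A = add (relation_group F N)"
    "zero A = zero (relation_group F N)"
  shows "abelian_group A"
proof (rule abelian_groupI)
  have [simp]: "x \<in> carrier F" if "x \<in> N" for x using that N.subset by auto
  note [simp] = assms carrier_relation_group zero_relation_group add_relation_group
  have one: "derived F N = derived F N #> \<one>" using D.subset by simp
  {
    fix p assume "p \<in> carrier A"
    then obtain x where x: "x \<in> N" "p = derived F N #> x" by auto
    show "\<zero>\<^bsub>A\<^esub> \<oplus>\<^bsub>A\<^esub> p = p"
      using x by simp (subst one, simp add: der_coset_mult del: N.coset_mult_one)
    show "\<exists>q\<in>carrier A. q \<oplus>\<^bsub>A\<^esub> p = \<zero>\<^bsub>A\<^esub>"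
      using x one by (intro bexI[of _ "derived F N #> inv x"]) (auto simp: der_coset_mult)
    fix q assume "q \<in> carrier A"
    then obtain y where y: "y \<in> N" "q = derived F N #> y" by auto
    show "p \<oplus>\<^bsub>A\<^esub> q \<in> carrier A" using x y by (auto simp: der_coset_mult)
    show "p \<oplus>\<^bsub>A\<^esub> q = q \<oplus>\<^bsub>A\<^esub> p" using x y der_coset_comm by (simp add: der_coset_mult)
    fix r assume "r \<in> carrier A"
    then obtain z where z: "z \<in> N" "r = derived F N #> z" by auto
    show "p \<oplus>\<^bsub>A\<^esub> q \<oplus>\<^bsub>A\<^esub> r = p \<oplus>\<^bsub>A\<^esub> (q \<oplus>\<^bsub>A\<^esub> r)"
      using x y z by (simp add: der_coset_mult N.m_assoc)
  }
  show "\<zero>\<^bsub>A\<^esub> \<in> carrier A" using one N.one_closed by auto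
qed

theorem right_module_relation_module:
  "right_module (group_ring (F Mod N)) (relation_module F N)"
proof (rule right_module_group_ring[where act = "conj_act F N"])
  have sub: "x \<in> carrier F" if "x \<in> N" for x using that N.subset by auto
  let ?M = "relation_module F N" and ?G = "F Mod N"
  note simps = relation_module_simps(1-3) carrier_relation_group zero_relation_group
    add_relation_group carrier_FactGroup
  show "group ?G" by (rule N.factorgroup_is_group)
  show "abelian_group ?M" by (rule abelian_group_aux) (simp_all add: relation_module_simps)
  {
    fix p assume "p \<in> carrier ?M"
    then obtain x where x: "x \<in> N" "p = derived F N #> x" by (auto simp: simps)
    show "conj_act F N p \<one>\<^bsub>?G\<^esub> = p"
      using conj_act_coset[OF x(1) N.one_closed] x sub N.subset by simp
    show "p \<triangleleft>\<^bsub>?M\<^esub> c = lin_ext ?M (conj_act F N p) c" for c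
      by (simp add: relation_module_simps lin_ext_relation_module)
    fix g assume "g \<in> carrier ?G"
    then obtain v where v: "v \<in> carrier F" "g = N #> v" by (auto simp: simps)
    show "conj_act F N p g \<in> carrier ?M"
      using x v by (auto simp: simps conj_act_coset conj_closed)
    {
      fix h assume "h \<in> carrier ?G"
      then obtain w where w: "w \<in> carrier F" "h = N #> w" by (auto simp: simps)
      have conj: "inv (v \<otimes> w) \<otimes> x \<otimes> (v \<otimes> w) = inv w \<otimes> (inv v \<otimes> x \<otimes> v) \<otimes> w"
        using v w sub[OF x(1)] by (simp add: N.inv_mult_group N.m_assoc)
      show "conj_act F N p (g \<otimes>\<^bsub>?G\<^esub> h) = conj_act F N (conj_act F N p g) h"
        using x v w sub conj
        by (simp add: N.rcos_sum conj_act_coset conj_closed)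
    }
    fix q assume "q \<in> carrier ?M"
    then obtain y where y: "y \<in> N" "q = derived F N #> y" by (auto simp: simps)
    have "inv v \<otimes> x \<otimes> v \<otimes> (inv v \<otimes> y \<otimes> v) = inv v \<otimes> (x \<otimes> y) \<otimes> v"
      using sub[OF x(1)] sub[OF y(1)] v by (simp add: N.m_assoc) (simp flip: N.m_assoc)
    then show "conj_act F N (p \<oplus>\<^bsub>?M\<^esub> q) g
        = conj_act F N p g \<oplus>\<^bsub>?M\<^esub> conj_act F N q g"
      using x y v sub by (simp add: simps der_coset_mult conj_act_coset)
  }
qed

end


section \<open>The presentation of the free product of the groups \<open>C\<^bsub>r\<^sub>i\<^esub> \<times> \<int>\<close>\<close>

datatype gen = GenA nat | GenB nat

definition pres_gens :: "nat \<Rightarrow> gen set" where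
  "pres_gens n = GenA ` {1..n} \<union> GenB ` {1..n}"

definition pres_F :: "nat \<Rightarrow> (gen \<times> bool) list set monoid" where
  "pres_F n = free_group (pres_gens n)"

definition pres_a :: "nat \<Rightarrow> nat \<Rightarrow> (gen \<times> bool) list set" where
  "pres_a n i = free_gen (pres_gens n) (GenA i)"

definition pres_b :: "nat \<Rightarrow> nat \<Rightarrow> (gen \<times> bool) list set" where
  "pres_b n i = free_gen (pres_gens n) (GenB i)"

definition pres_R :: "nat \<Rightarrow> nat \<Rightarrow> (gen \<times> bool) list set" where
  "pres_R n i = pres_a n i \<otimes>\<^bsub>pres_F n\<^esub> pres_b n i \<otimes>\<^bsub>pres_F n\<^esub>
     inv\<^bsub>pres_F n\<^esub> pres_a n i \<otimes>\<^bsub>pres_F n\<^esub> inv\<^bsub>pres_F n\<^esub> pres_b n i"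

definition pres_S :: "nat \<Rightarrow> (nat \<Rightarrow> nat) \<Rightarrow> nat \<Rightarrow> (gen \<times> bool) list set" where
  "pres_S n r i = pres_a n i [^]\<^bsub>pres_F n\<^esub> r i"

definition pres_N :: "nat \<Rightarrow> (nat \<Rightarrow> nat) \<Rightarrow> (gen \<times> bool) list set set" where
  "pres_N n r = normal_closure (pres_F n) (pres_R n ` {1..n} \<union> pres_S n r ` {1..n})"

definition pres_G :: "nat \<Rightarrow> (nat \<Rightarrow> nat) \<Rightarrow> (gen \<times> bool) list set set monoid" where
  "pres_G n r = pres_F n Mod pres_N n r"

definition pres_ZG ::
    "nat \<Rightarrow> (nat \<Rightarrow> nat) \<Rightarrow> ((gen \<times> bool) list set set \<Rightarrow>\<^sub>0 int) ring" where
  "pres_ZG n r = group_ring (pres_G n r)"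

definition pres_M :: "nat \<Rightarrow> (nat \<Rightarrow> nat) \<Rightarrow>
    ((gen \<times> bool) list set set \<Rightarrow>\<^sub>0 int, (gen \<times> bool) list set set) right_module" where
  "pres_M n r = relation_module (pres_F n) (pres_N n r)"

definition pres_aZ :: "nat \<Rightarrow> (nat \<Rightarrow> nat) \<Rightarrow> nat \<Rightarrow> (gen \<times> bool) list set set \<Rightarrow>\<^sub>0 int" where
  "pres_aZ n r i = frag_of (pres_N n r #>\<^bsub>pres_F n\<^esub> pres_a n i)"

definition pres_D :: "nat \<Rightarrow> (nat \<Rightarrow> nat) \<Rightarrow> nat \<Rightarrow> (gen \<times> bool) list set set" where
  "pres_D n r i = derived (pres_F n) (pres_N n r) #>\<^bsub>pres_F n\<^esub> pres_R n i"

definition pres_E :: "nat \<Rightarrow> (nat \<Rightarrow> nat) \<Rightarrow> nat \<Rightarrow> (gen \<times> bool) list set set" where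
  "pres_E n r i = derived (pres_F n) (pres_N n r) #>\<^bsub>pres_F n\<^esub> pres_S n r i"

lemma pres_relators_closed: "pres_R n ` {1..n} \<union> pres_S n r ` {1..n} \<subseteq> carrier (pres_F n)"
proof -
  interpret F: group "pres_F n" unfolding pres_F_def by (rule group_free_group)
  have "pres_a n i \<in> carrier (pres_F n)" "pres_b n i \<in> carrier (pres_F n)"
    if "i \<in> {1..n}" for i
    using that unfolding pres_a_def pres_b_def pres_F_def
    by (auto intro!: free_gen_closed simp: pres_gens_def)
  then show ?thesis by (auto simp: pres_R_def pres_S_def)
qed

lemma pres_N_normal: "pres_N n r \<lhd> pres_F n"
  unfolding pres_N_def
  using group.normal_closure_normal[OF _ pres_relators_closed] group_free_group pres_F_def
  by metis

lemma right_module_pres_M: "right_module (pres_ZG n r) (pres_M n r)"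
  unfolding pres_ZG_def pres_G_def pres_M_def
  by (rule right_module_relation_module[OF pres_N_normal])

lemma pres_D_E_closed:
  assumes "i \<in> {1..n}"
  shows "pres_D n r i \<in> carrier (pres_M n r)" "pres_E n r i \<in> carrier (pres_M n r)"
proof -
  have "pres_R n i \<in> pres_N n r" "pres_S n r i \<in> pres_N n r"
    using assms by (auto simp: pres_N_def normal_closure_def)
  then show "pres_D n r i \<in> carrier (pres_M n r)" "pres_E n r i \<in> carrier (pres_M n r)"
    unfolding pres_D_def pres_E_def pres_M_def relation_module_simps(1)
      carrier_relation_group by auto
qed

lemma pres_aZ_closed: "i \<in> {1..n} \<Longrightarrow> pres_aZ n r i \<in> carrier (pres_ZG n r)"
  by (auto simp: pres_aZ_def pres_ZG_def pres_G_def group_ring_simps carrier_FactGroup pres_a_def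
      pres_F_def pres_gens_def intro!: imageI free_gen_closed)

end

theory Submission
  imports Defs
begin

text \<open>
  Let \<open>H\<close> be a submodule of \<open>M = N/[N,N]\<close> that contains \<open>X\<^sub>1, \<dots>, X\<^sub>n\<^sub>+\<^sub>1\<close>, and let \<open>K\<close> be the set of
  those \<open>x \<in> N\<close> whose class lies in \<open>H\<close>. Then \<open>K\<close> is a normal subgroup of \<open>F\<close> containing
  \<open>[N,N]\<close>, and it is enough to show that \<open>K\<close> contains every \<open>R\<^sub>i\<close> and \<open>S\<^sub>i\<close>: being normal, it then
  contains \<open>N\<close>, so that \<open>H = M\<close>.

  The heart of the proof is a computation in the group \<open>F/K\<close>, for a fixed \<open>i\<close>, with \<open>c\<close> and \<open>s\<close> the
  images of \<open>R\<^sub>i = [a,b]\<close> and \<open>S\<^sub>i = a\<^sup>r\<close>. They commute because \<open>[N,N] \<subseteq> K\<close>, and \<open>X\<^sub>i \<in> H\<close> says that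
  \<open>a\<^sup>-\<^sup>1ca = sc\<close>. Hence conjugation by \<open>a\<close> multiplies \<open>c\<close> by \<open>s\<close> each time. Conjugation by \<open>s = a\<^sup>r\<close>
  therefore multiplies it by \<open>s\<^sup>r\<close>, but also fixes it, so \<open>s\<^sup>r = 1\<close>. On the other hand
  \<open>bab\<^sup>-\<^sup>1 = c\<^sup>-\<^sup>1a\<close>, and collecting the factors of \<open>(c\<^sup>-\<^sup>1a)\<^sup>r\<close> shows that \<open>bsb\<^sup>-\<^sup>1\<close> is \<open>c\<^sup>-\<^sup>r\<close> times a
  power of \<open>s\<close>. Raising this to the power \<open>r\<close> kills all powers of \<open>s\<close> and leaves \<open>c\<close> to the power
  \<open>r\<^sup>2\<close> equal to \<open>1\<close>. This is \<open>twisted_commutator_torsion\<close>.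

  So \<open>D\<^sub>i\<close> has order dividing \<open>r\<^sub>i\<^sup>2\<close> in \<open>M/H\<close>, and these numbers are pairwise coprime. Elements of
  pairwise coprime orders whose sum vanishes all vanish
  (\<open>coprime_torsion_factors_mem_subgroup\<close>), so \<open>X\<^sub>n\<^sub>+\<^sub>1 \<in> H\<close> gives \<open>D\<^sub>i \<in> H\<close> for all \<open>i\<close>; finally
  \<open>E\<^sub>i \<in> H\<close> because \<open>X\<^sub>i \<in> H\<close>.
\<close>

section \<open>Coprime torsion in abelian groups\<close>

lemma (in group) subgroup_nat_pow_closed:
  assumes "subgroup H G" "x \<in> H"
  shows "x [^] (k::nat) \<in> H"
proof (induction k)
  case 0
  then show ?case using assms by (simp add: subgroup.one_closed)
next
  case (Suc k)
  then show ?case using assms by (simp add: subgroup.m_closed)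
qed

lemma (in group) coprime_powers_mem_subgroup:
  fixes p q :: nat
  assumes H: "subgroup H G" and x: "x \<in> carrier G"
    and "x [^] p \<in> H" "x [^] q \<in> H" "coprime p q"
  shows "x \<in> H"
proof -
  obtain s t :: int where st: "s * int p + t * int q = 1"
    using assms(5) bezout_int[of "int p" "int q"] by (auto simp: coprime_iff_gcd_eq_1)
  have *: "x [^] (int k * s) \<in> H" if "x [^] k \<in> H" for k :: nat and s :: int
  proof -
    have "x [^] (int k * s) = (x [^] k) [^] s"
      using x by (simp add: int_pow_pow flip: int_pow_int)
    then show ?thesis using subgroup_int_pow_closed[OF H that] by simp
  qed
  have "x = x [^] (int p * s + int q * t)"
    using st x by (simp add: mult.commute)
  also have "\<dots> = x [^] (int p * s) \<otimes> x [^] (int q * t)"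
    using x by (simp add: int_pow_mult)
  finally have "x = x [^] (int p * s) \<otimes> x [^] (int q * t)" .
  moreover have "\<dots> \<in> H"
    using *[OF assms(3)] *[OF assms(4)] by (rule subgroup.m_closed[OF H])
  ultimately show ?thesis by simp
qed

lemma (in comm_group) finprod_pow_mem_subgroup:
  fixes m :: nat
  assumes H: "subgroup H G" and "f \<in> I \<rightarrow> carrier G" and "\<And>i. i \<in> I \<Longrightarrow> f i [^] m \<in> H"
  shows "finprod G f I [^] m \<in> H"
  using assms(2,3)
proof (induction I rule: infinite_finite_induct)
  case (insert i I)
  then have "f i \<in> carrier G" "f \<in> I \<rightarrow> carrier G" by auto
  then show ?case using insert H by (simp add: nat_pow_distrib subgroup.m_closed)
qed (simp_all add: subgroup.one_closed[OF H])

text \<open>Raise the product to the power \<open>m = (\<Prod>i \<noteq> j. q i)\<close>. Modulo \<open>H\<close> this removes every factor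
  except \<open>f j\<close>, whence \<open>f j\<close> is killed by \<open>m\<close> as well as by \<open>q j\<close>, which is coprime to it.\<close>

lemma (in comm_group) coprime_torsion_factors_mem_subgroup:
  fixes q :: "'i \<Rightarrow> nat"
  assumes H: "subgroup H G" and I: "finite I" and f: "f \<in> I \<rightarrow> carrier G"
    and tors: "\<And>i. i \<in> I \<Longrightarrow> f i [^] q i \<in> H"
    and cop: "\<And>i j. i \<in> I \<Longrightarrow> j \<in> I \<Longrightarrow> i \<noteq> j \<Longrightarrow> coprime (q i) (q j)"
    and prod: "finprod G f I \<in> H" and j: "j \<in> I"
  shows "f j \<in> H"
proof -
  define m where "m = (\<Prod>i\<in>I - {j}. q i)"
  have fj: "f j \<in> carrier G" and fI: "f \<in> (I - {j}) \<rightarrow> carrier G" using f j by auto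
  let ?P = "finprod G f (I - {j})"
  have P: "?P \<in> carrier G" using fI by simp
  have "finprod G f I = f j \<otimes> ?P"
    using finprod_insert[of "I - {j}" j f] I fj fI j by (simp add: insert_absorb)
  then have "f j [^] m \<otimes> ?P [^] m \<in> H"
    using subgroup_nat_pow_closed[OF H prod, of m] fj P by (simp add: nat_pow_distrib)
  moreover have "f i [^] m \<in> H" if i: "i \<in> I - {j}" for i
  proof -
    obtain k where "m = q i * k"
      using dvd_prodI[of "I - {j}" i q] I i by (auto simp: m_def dvd_def)
    then have "f i [^] m = (f i [^] q i) [^] k"
      using f i by (simp add: nat_pow_pow Pi_iff)
    then show ?thesis using subgroup_nat_pow_closed[OF H tors] i by simp
  qed
  then have "?P [^] m \<in> H" by (rule finprod_pow_mem_subgroup[OF H fI])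
  ultimately have "f j [^] m \<otimes> ?P [^] m \<otimes> inv (?P [^] m) \<in> H"
    by (rule subgroup.m_closed[OF H _ subgroup.m_inv_closed[OF H]])
  then have "f j [^] m \<in> H" using fj P by (simp add: m_assoc)
  moreover have "coprime m (q j)"
    unfolding m_def by (rule prod_coprime_left) (use cop j in auto)
  ultimately show ?thesis
    using coprime_powers_mem_subgroup[OF H fj] tors[OF j] by blast
qed

section \<open>Torsion of a commutator\<close>

lemma (in group) conj_nat_pow:
  assumes "x \<in> carrier G" "y \<in> carrier G"
  shows "(x \<otimes> y \<otimes> inv x) [^] (k::nat) = x \<otimes> y [^] k \<otimes> inv x"
proof (induction k)
  case (Suc k)
  have "x \<otimes> y [^] k \<otimes> inv x \<otimes> (x \<otimes> y \<otimes> inv x)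
      = x \<otimes> y [^] k \<otimes> (inv x \<otimes> x) \<otimes> y \<otimes> inv x"
    using assms by (simp only: m_assoc m_closed inv_closed nat_pow_closed)
  then show ?case using Suc assms by (simp add: m_assoc)
qed (use assms in simp)

lemma (in group) commute_nat_pow:
  assumes "x \<in> carrier G" "y \<in> carrier G" "x \<otimes> y = y \<otimes> x"
  shows "x \<otimes> y [^] (k::nat) = y [^] k \<otimes> x"
  using group_commutes_pow[of y x k] assms by simp

text \<open>The subgroup generated by \<open>a\<close>, \<open>c\<close>, \<open>s\<close> is a quotient of the Heisenberg group with central
  element \<open>s\<close>, so words in \<open>a\<close> and \<open>c\<close> can be collected at the cost of powers of \<open>s\<close>.\<close>

lemma (in group) twisted_commutator_torsion:
  fixes r :: nat
  assumes a: "a \<in> carrier G" and b: "b \<in> carrier G"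
    and c_def: "c = a \<otimes> b \<otimes> inv a \<otimes> inv b" and s_def: "s = a [^] r"
    and cs: "c \<otimes> s = s \<otimes> c" and tw: "inv a \<otimes> c \<otimes> a = s \<otimes> c"
  shows "c [^] (r\<^sup>2) = \<one>"
proof -
  have c: "c \<in> carrier G" and s: "s \<in> carrier G" using a b by (auto simp: c_def s_def)
  note [simp] = a b c s
  have as: "a \<otimes> s = s \<otimes> a" unfolding s_def by (rule commute_nat_pow) simp_all
  have ca: "c \<otimes> a = a \<otimes> (s \<otimes> c)"
    unfolding tw[symmetric] by (simp flip: m_assoc)
  have cak: "c \<otimes> a [^] k = a [^] k \<otimes> (s [^] k \<otimes> c)" for k :: nat
  proof (induction k)
    case (Suc k)
    have "c \<otimes> (a [^] k \<otimes> a) = (c \<otimes> a [^] k) \<otimes> a" by (simp add: m_assoc)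
    also have "\<dots> = a [^] k \<otimes> (s [^] k \<otimes> (c \<otimes> a))" unfolding Suc by (simp add: m_assoc)
    also have "\<dots> = a [^] k \<otimes> ((s [^] k \<otimes> a) \<otimes> (s \<otimes> c))" unfolding ca by (simp add: m_assoc)
    also have "s [^] k \<otimes> a = a \<otimes> s [^] k" using commute_nat_pow[of a s k] as by simp
    finally show ?case by (simp add: m_assoc)
  qed simp
  \<comment> \<open>Taking \<open>k = r\<close> compares two expressions for \<open>c \<otimes> s\<close>.\<close>
  have sr: "s [^] r = \<one>"
  proof -
    have "s \<otimes> (s [^] r \<otimes> c) = s \<otimes> c" using cak[of r] cs by (simp flip: s_def)
    then have "s [^] r \<otimes> c = c" by simp
    then show ?thesis by simp
  qed
  define d where "d = inv c"
  have d[simp]: "d \<in> carrier G" by (simp add: d_def)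
  have ds: "d \<otimes> s = s \<otimes> d"
  proof -
    have "d \<otimes> s = d \<otimes> (s \<otimes> c) \<otimes> d" by (simp add: d_def m_assoc)
    also have "\<dots> = s \<otimes> d" unfolding cs[symmetric] by (simp add: d_def flip: m_assoc)
    finally show ?thesis .
  qed
  have da: "a [^] k \<otimes> d = d \<otimes> (s [^] k \<otimes> a [^] k)" for k :: nat
  proof -
    have sa: "s [^] k \<otimes> a [^] k = a [^] k \<otimes> s [^] k"
      using commute_nat_pow[of "s [^] k" a k] commute_nat_pow[of a s k] as by simp
    have sc: "s [^] k \<otimes> c = c \<otimes> s [^] k" using commute_nat_pow[of c s k] cs by simp
    have "c \<otimes> (a [^] k \<otimes> d) = a [^] k \<otimes> (s [^] k \<otimes> c) \<otimes> d" by (simp add: cak flip: m_assoc)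
    also have "\<dots> = a [^] k \<otimes> s [^] k" by (simp add: d_def m_assoc)
    finally have "d \<otimes> (c \<otimes> (a [^] k \<otimes> d)) = d \<otimes> (a [^] k \<otimes> s [^] k)" by simp
    then show ?thesis using sa by (simp add: d_def flip: m_assoc)
  qed
  \<comment> \<open>Moving the next \<open>d\<close> to the left past \<open>a [^] k\<close> costs \<open>s [^] k\<close>; these costs add up.\<close>
  have pow: "(d \<otimes> a) [^] k = d [^] k \<otimes> (s [^] (\<Sum>{..<k}) \<otimes> a [^] k)" for k :: nat
  proof (induction k)
    case (Suc k)
    let ?t = "s [^] (\<Sum>{..<k})"
    have "(d \<otimes> a) [^] Suc k = d [^] k \<otimes> (?t \<otimes> ((a [^] k \<otimes> d) \<otimes> a))"
      using Suc by (simp add: m_assoc)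
    also have "\<dots> = d [^] k \<otimes> ((?t \<otimes> d) \<otimes> (s [^] k \<otimes> (a [^] k \<otimes> a)))"
      unfolding da by (simp add: m_assoc)
    also have "?t \<otimes> d = d \<otimes> ?t" using commute_nat_pow[of d s] ds by simp
    also have "d [^] k \<otimes> (d \<otimes> ?t \<otimes> (s [^] k \<otimes> (a [^] k \<otimes> a)))
        = (d [^] k \<otimes> d) \<otimes> ((?t \<otimes> s [^] k) \<otimes> (a [^] k \<otimes> a))" by (simp add: m_assoc)
    finally show ?case by (simp add: nat_pow_mult lessThan_Suc add.commute)
  qed simp
  \<comment> \<open>For \<open>k = r\<close> the trailing \<open>a [^] r\<close> is one more factor \<open>s\<close>.\<close>
  let ?m = "\<Sum>{..<r} + 1"
  have bab: "b \<otimes> a \<otimes> inv b = d \<otimes> a"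
    unfolding d_def c_def by (simp add: inv_mult_group m_assoc)
  have "b \<otimes> s \<otimes> inv b = d [^] r \<otimes> s [^] ?m"
    using conj_nat_pow[of b a r] pow[of r] unfolding bab by (simp flip: s_def)
  then have "b \<otimes> s [^] r \<otimes> inv b = (d [^] r \<otimes> s [^] ?m) [^] r"
    using conj_nat_pow[of b s r] by simp
  also have "\<dots> = (d [^] r) [^] r \<otimes> (s [^] ?m) [^] r"
  proof (rule pow_mult_distrib)
    have "s [^] ?m \<otimes> d [^] r = d [^] r \<otimes> s [^] ?m"
      by (rule commute_nat_pow) (simp_all only: d s nat_pow_closed commute_nat_pow[OF d s ds])
    then show "d [^] r \<otimes> s [^] ?m = s [^] ?m \<otimes> d [^] r" by simp
  qed simp_all
  also have "(s [^] ?m) [^] r = (s [^] r) [^] ?m" by (simp only: nat_pow_pow s mult.commute)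
  finally have "d [^] (r\<^sup>2) = \<one>"
    using sr by (simp add: nat_pow_pow power2_eq_square)
  then show ?thesis unfolding d_def by (simp add: nat_pow_inv)
qed

section \<open>Submodules of a relation module as normal subgroups\<close>

lemma (in right_module) rsmult_one_minus:
  assumes "x \<in> carrier M" "c \<in> carrier R"
  shows "x \<triangleleft>\<^bsub>M\<^esub> (\<one>\<^bsub>R\<^esub> \<ominus>\<^bsub>R\<^esub> c) = x \<ominus>\<^bsub>M\<^esub> x \<triangleleft>\<^bsub>M\<^esub> c"
proof (rule M.diff_eqI)
  have "(\<one>\<^bsub>R\<^esub> \<ominus>\<^bsub>R\<^esub> c) \<oplus>\<^bsub>R\<^esub> c = \<one>\<^bsub>R\<^esub>"
    using assms by (simp add: R.minus_eq R.a_assoc R.l_neg)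
  then show "x = x \<triangleleft>\<^bsub>M\<^esub> (\<one>\<^bsub>R\<^esub> \<ominus>\<^bsub>R\<^esub> c) \<oplus>\<^bsub>M\<^esub> x \<triangleleft>\<^bsub>M\<^esub> c"
    using assms rsmult_r_distr[of x "\<one>\<^bsub>R\<^esub> \<ominus>\<^bsub>R\<^esub> c" c] rsmult_one by simp
qed (use assms in \<open>simp_all add: rsmult_closed\<close>)

definition submodule_preimage :: "('a, 'b) monoid_scheme \<Rightarrow> 'a set \<Rightarrow> 'a set set \<Rightarrow> 'a set" where
  "submodule_preimage F N H = {x \<in> N. derived F N #>\<^bsub>F\<^esub> x \<in> H}"

context
  fixes F :: "('a, 'b) monoid_scheme" (structure) and N :: "'a set"
  assumes N: "N \<lhd> F"
begin

interpretation N: normal N F by (rule N)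
interpretation D: normal "derived F N" F by (rule N.derived_is_normal[OF N])
interpretation M: right_module "group_ring (F Mod N)" "relation_module F N"
  by (rule right_module_relation_module[OF N])

lemma relation_module_coset_hom:
  "group_hom (F\<lparr>carrier := N\<rparr>) (add_monoid (relation_module F N)) (\<lambda>x. derived F N #> x)"
proof (rule group_hom.intro)
  show "group (F\<lparr>carrier := N\<rparr>)" by (rule N.subgroup_imp_group[OF N.is_subgroup])
  show "group (add_monoid (relation_module F N))" by (rule M.a_group)
  show "group_hom_axioms (F\<lparr>carrier := N\<rparr>) (add_monoid (relation_module F N))
      (\<lambda>x. derived F N #> x)"
    using N.subset
    by (auto simp: group_hom_axioms_def hom_def relation_module_simps carrier_relation_group
        add_relation_group der_coset_mult[OF N] subset_iff)
qed

interpretation h: group_hom "F\<lparr>carrier := N\<rparr>" "add_monoid (relation_module F N)"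
  "\<lambda>x. derived F N #> x"
  by (rule relation_module_coset_hom)

lemma relation_module_coset_pow:
  assumes "x \<in> N"
  shows "derived F N #> (x [^] (k::nat)) = [k] \<cdot>\<^bsub>relation_module F N\<^esub> (derived F N #> x)"
proof -
  have "x [^]\<^bsub>F\<lparr>carrier := N\<rparr>\<^esub> k = x [^] k" by (simp add: nat_pow_def)
  then show ?thesis using h.hom_nat_pow[of x k] assms by (simp add: add_pow_def)
qed

lemma relation_module_coset_diff:
  assumes "x \<in> N" "y \<in> N"
  shows "derived F N #> (x \<otimes> inv y)
    = (derived F N #> x) \<ominus>\<^bsub>relation_module F N\<^esub> (derived F N #> y)"
proof -
  have "inv\<^bsub>F\<lparr>carrier := N\<rparr>\<^esub> y = inv y" using N.m_inv_consistent[OF N.is_subgroup assms(2)] .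
  then show ?thesis
    using h.hom_mult[of x "inv y"] h.hom_inv[of y] assms
    by (simp add: a_minus_def a_inv_def)
qed

lemma relation_module_coset_act:
  assumes "x \<in> N" "w \<in> carrier F"
  shows "(derived F N #> x) \<triangleleft>\<^bsub>relation_module F N\<^esub> frag_of (N #> w)
    = derived F N #> (inv w \<otimes> x \<otimes> w)"
proof -
  have "derived F N #> (inv w \<otimes> x \<otimes> w) \<in> carrier (relation_module F N)"
    using h.hom_closed[of "inv w \<otimes> x \<otimes> w"] conj_closed[OF N assms] by simp
  then show ?thesis
    using assms
    by (simp add: relation_module_simps(4) lin_ext_relation_module M.lin_ext_of
        conj_act_coset[OF N])
qed

context
  fixes H assumes H: "right_submodule H (group_ring (F Mod N)) (relation_module F N)"
begin

interpretation H: subgroup H "add_monoid (relation_module F N)"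
  using H by (simp add: right_submodule_def)

lemma derived_subset_submodule_preimage: "derived F N \<subseteq> submodule_preimage F N H"
proof
  fix x assume x: "x \<in> derived F N"
  have "derived F N \<subseteq> N" by (rule N.derived_incl[OF order_refl N.is_subgroup])
  moreover have "derived F N #> x = derived F N"
    using x D.subset by (intro N.coset_join2 D.is_subgroup) auto
  moreover have "derived F N \<in> H"
    using H.one_closed by (simp add: relation_module_simps zero_relation_group)
  ultimately show "x \<in> submodule_preimage F N H" using x by (auto simp: submodule_preimage_def)
qed

lemma submodule_preimage_normal: "submodule_preimage F N H \<lhd> F"
proof -
  let ?K = "submodule_preimage F N H"
  have sub: "x \<in> carrier F" if "x \<in> N" for x using that N.subset by auto
  have "subgroup ?K F"
  proof (rule N.subgroupI)
    show "?K \<subseteq> carrier F" using sub by (auto simp: submodule_preimage_def)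
    show "?K \<noteq> {}" using derived_subset_submodule_preimage D.one_closed by blast
    fix x assume x: "x \<in> ?K"
    have "inv\<^bsub>F\<lparr>carrier := N\<rparr>\<^esub> x = inv x"
      using x N.m_inv_consistent[OF N.is_subgroup] by (simp add: submodule_preimage_def)
    then show "inv x \<in> ?K"
      using x h.hom_inv[of x] H.m_inv_closed by (auto simp: submodule_preimage_def)
    fix y assume "y \<in> ?K"
    then show "x \<otimes> y \<in> ?K"
      using x h.hom_mult[of x y] H.m_closed by (auto simp: submodule_preimage_def)
  qed
  moreover have "w \<otimes> x \<otimes> inv w \<in> ?K" if w: "w \<in> carrier F" and x: "x \<in> ?K" for w x
  proof -
    have xN: "x \<in> N" and xH: "derived F N #> x \<in> H"
      using x by (auto simp: submodule_preimage_def)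
    have "frag_of (N #> inv w) \<in> carrier (group_ring (F Mod N))"
      using w by (simp add: group_ring_simps carrier_FactGroup)
    then have "(derived F N #> x) \<triangleleft>\<^bsub>relation_module F N\<^esub> frag_of (N #> inv w) \<in> H"
      using H xH by (simp add: right_submodule_def)
    then show ?thesis
      using relation_module_coset_act[OF xN, of "inv w"] w conj_closed[OF N xN, of "inv w"]
      by (simp add: submodule_preimage_def)
  qed
  ultimately show ?thesis by (simp add: N.normal_inv_iff)
qed

text \<open>\<open>N/K\<close> is a quotient of the abelian group \<open>N/[N,N]\<close>.\<close>

lemma coset_submodule_preimage_commute:
  assumes x: "x \<in> N" and y: "y \<in> N"
  shows "submodule_preimage F N H #> (x \<otimes> y) = submodule_preimage F N H #> (y \<otimes> x)"
proof -
  interpret K: normal "submodule_preimage F N H" F by (rule submodule_preimage_normal)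
  have xy: "x \<in> carrier F" "y \<in> carrier F" using x y N.subset by auto
  have "x \<otimes> y \<in> derived F N #> (x \<otimes> y)" by (rule N.rcos_self[OF _ D.is_subgroup]) (use xy in simp)
  then have "x \<otimes> y \<in> derived F N #> (y \<otimes> x)" using der_coset_comm[OF N x y] by simp
  then have "x \<otimes> y \<in> submodule_preimage F N H #> (y \<otimes> x)"
    using derived_subset_submodule_preimage by (auto simp: r_coset_def)
  then show ?thesis
    using N.repr_independence[OF _ _ K.is_subgroup] xy by simp
qed

text \<open>The hypothesis \<open>tw\<close> says in additive notation that \<open>E + D(1 - a)\<close> lies in \<open>H\<close>, where \<open>D\<close> and
  \<open>E\<close> are the classes of \<open>c\<close> and \<open>s\<close>. In \<open>F/K\<close> it is the twisting relation for \<open>c\<close> and \<open>s\<close>.\<close>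

lemma twisted_commutator_torsion_mod_submodule:
  fixes r :: nat
  assumes a: "a \<in> carrier F" and b: "b \<in> carrier F"
    and c_def: "c = a \<otimes> b \<otimes> inv a \<otimes> inv b" and s_def: "s = a [^] r"
    and c: "c \<in> N" and s: "s \<in> N"
    and tw: "s \<otimes> c \<otimes> inv (inv a \<otimes> c \<otimes> a) \<in> submodule_preimage F N H"
  shows "c [^] (r\<^sup>2) \<in> submodule_preimage F N H"
    and "c \<in> submodule_preimage F N H \<Longrightarrow> s \<in> submodule_preimage F N H"
proof -
  let ?K = "submodule_preimage F N H"
  interpret K: normal ?K F by (rule submodule_preimage_normal)
  interpret P: group "F Mod ?K" by (rule K.factorgroup_is_group)
  have carr: "c \<in> carrier F" "s \<in> carrier F" using c s N.subset by auto
  interpret p: group_hom F "F Mod ?K" "\<lambda>x. ?K #> x"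
    by (intro group_hom.intro group_hom_axioms.intro N.is_group P.is_group K.r_coset_hom_Mod)
  have ker: "?K #> x = \<one>\<^bsub>F Mod ?K\<^esub> \<longleftrightarrow> x \<in> ?K" if "x \<in> carrier F" for x
    using that N.coset_join1[OF _ that K.is_subgroup] N.coset_join2[OF that K.is_subgroup]
    by (auto simp: FactGroup_def)
  have "(?K #> c) [^]\<^bsub>F Mod ?K\<^esub> r\<^sup>2 = \<one>\<^bsub>F Mod ?K\<^esub>"
  proof (rule P.twisted_commutator_torsion[of "?K #> a" "?K #> b"])
    show "?K #> a \<in> carrier (F Mod ?K)" "?K #> b \<in> carrier (F Mod ?K)" using a b by simp_all
    show "?K #> c = (?K #> a) \<otimes>\<^bsub>F Mod ?K\<^esub> (?K #> b) \<otimes>\<^bsub>F Mod ?K\<^esub> inv\<^bsub>F Mod ?K\<^esub> (?K #> a)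
        \<otimes>\<^bsub>F Mod ?K\<^esub> inv\<^bsub>F Mod ?K\<^esub> (?K #> b)"
      using a b by (simp add: c_def p.hom_mult p.hom_inv del: mult_FactGroup)
    show "?K #> s = (?K #> a) [^]\<^bsub>F Mod ?K\<^esub> r" using a by (simp add: s_def p.hom_nat_pow)
    show "(?K #> c) \<otimes>\<^bsub>F Mod ?K\<^esub> (?K #> s) = (?K #> s) \<otimes>\<^bsub>F Mod ?K\<^esub> (?K #> c)"
      using coset_submodule_preimage_commute[OF c s] carr by (simp add: p.hom_mult del: mult_FactGroup)
    let ?p = "?K #> (s \<otimes> c)" and ?q = "?K #> (inv a \<otimes> c \<otimes> a)"
    have p: "?p \<in> carrier (F Mod ?K)" by (rule p.hom_closed) (use a carr in simp)
    have q: "?q \<in> carrier (F Mod ?K)" by (rule p.hom_closed) (use a carr in simp)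
    have "?p \<otimes>\<^bsub>F Mod ?K\<^esub> inv\<^bsub>F Mod ?K\<^esub> ?q = \<one>\<^bsub>F Mod ?K\<^esub>"
      using tw a carr ker[of "s \<otimes> c \<otimes> inv (inv a \<otimes> c \<otimes> a)"]
      by (simp add: p.hom_mult p.hom_inv del: mult_FactGroup)
    then have "?p = ?q"
      using P.inv_equality[of ?p "inv\<^bsub>F Mod ?K\<^esub> ?q"] p q
      by (simp only: P.inv_closed P.inv_inv)
    then show "inv\<^bsub>F Mod ?K\<^esub> (?K #> a) \<otimes>\<^bsub>F Mod ?K\<^esub> (?K #> c) \<otimes>\<^bsub>F Mod ?K\<^esub> (?K #> a)
        = (?K #> s) \<otimes>\<^bsub>F Mod ?K\<^esub> (?K #> c)"
      using a carr by (simp add: p.hom_mult p.hom_inv del: mult_FactGroup)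
  qed
  then show "c [^] (r\<^sup>2) \<in> ?K"
    using ker[of "c [^] r\<^sup>2"] carr by (simp add: p.hom_nat_pow)
  assume cK: "c \<in> ?K"
  let ?y = "c \<otimes> inv (inv a \<otimes> c \<otimes> a)"
  have y: "?y \<in> ?K"
    using cK a by (intro K.m_closed K.m_inv_closed K.inv_op_closed1) auto
  have "s \<otimes> ?y \<in> ?K" using tw a carr by (simp add: N.m_assoc)
  then have "s \<otimes> ?y \<otimes> inv ?y \<in> ?K" using y by (rule K.m_closed[OF _ K.m_inv_closed])
  moreover have "s \<otimes> ?y \<otimes> inv ?y = s"
    using a carr by (simp only: N.m_assoc N.m_closed N.inv_closed N.r_inv N.r_one)
  ultimately show "s \<in> ?K" by simp
qed

end

end

section \<open>Generation of the relation module\<close>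

theorem theorem2p2:
  fixes n :: nat and r :: "nat \<Rightarrow> nat"
  assumes "n \<ge> 1"
    and "\<forall>i\<in>{1..n}. r i \<ge> 2"
    and "\<forall>i\<in>{1..n}. \<forall>j\<in>{1..n}. i \<noteq> j \<longrightarrow> coprime (r i) (r j)"
  shows
    "let ZG = pres_ZG n r;
         M = pres_M n r;
         a = pres_aZ n r;
         D = pres_D n r;
         E = pres_E n r;
         Xs = (\<lambda>i. if i \<le> n then E i \<oplus>\<^bsub>M\<^esub> D i \<triangleleft>\<^bsub>M\<^esub> (\<one>\<^bsub>ZG\<^esub> \<ominus>\<^bsub>ZG\<^esub> a i)
                   else (\<Oplus>\<^bsub>M\<^esub>j\<in>{1..n}. D j))
     in right_span ZG M (Xs ` {1..n + 1}) = carrier M"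
proof -
  define F N where "F = pres_F n" and "N = pres_N n r"
  define M where "M = pres_M n r"
  define ZG where "ZG = pres_ZG n r"
  define D E where "D = pres_D n r" and "E = pres_E n r"
  define a where "a = pres_aZ n r"
  define Xs where "Xs = (\<lambda>i. if i \<le> n then E i \<oplus>\<^bsub>M\<^esub> D i \<triangleleft>\<^bsub>M\<^esub> (\<one>\<^bsub>ZG\<^esub> \<ominus>\<^bsub>ZG\<^esub> a i)
                   else (\<Oplus>\<^bsub>M\<^esub>j\<in>{1..n}. D j))"
  have M_eq: "M = relation_module F N" and ZG_eq: "ZG = group_ring (F Mod N)"
    by (simp_all add: M_def ZG_def F_def N_def pres_M_def pres_ZG_def pres_G_def)
  have N: "N \<lhd> F" unfolding N_def F_def by (rule pres_N_normal)
  interpret N: normal N F by (rule N)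
  interpret M: right_module ZG M unfolding ZG_def M_def by (rule right_module_pres_M)
  let ?c = "\<lambda>x. derived F N #>\<^bsub>F\<^esub> x"
  interpret h: group_hom "F\<lparr>carrier := N\<rparr>" "add_monoid M" ?c
    unfolding M_eq by (rule relation_module_coset_hom[OF N])
  have D: "D i \<in> carrier M" and E: "E i \<in> carrier M" and a: "a i \<in> carrier ZG"
    if "i \<in> {1..n}" for i
    using that pres_D_E_closed pres_aZ_closed unfolding D_def E_def M_def a_def ZG_def by auto
  have ab: "pres_a n i \<in> carrier F" "pres_b n i \<in> carrier F" if "i \<in> {1..n}" for i
    using that unfolding F_def pres_a_def pres_b_def pres_F_def
    by (auto intro!: free_gen_closed simp: pres_gens_def)
  have RS: "pres_R n i \<in> N" "pres_S n r i \<in> N" if "i \<in> {1..n}" for i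
    using that by (auto simp: N_def pres_N_def normal_closure_def)
  \<comment> \<open>An element of \<open>N\<close> that represents \<open>E i + D i (1 - a i)\<close>.\<close>
  have Xs_first: "Xs i = ?c (pres_S n r i \<otimes>\<^bsub>F\<^esub> pres_R n i \<otimes>\<^bsub>F\<^esub>
      inv\<^bsub>F\<^esub> (inv\<^bsub>F\<^esub> pres_a n i \<otimes>\<^bsub>F\<^esub> pres_R n i \<otimes>\<^bsub>F\<^esub> pres_a n i))"
    if i: "i \<in> {1..n}" for i
  proof -
    let ?R = "pres_R n i" and ?S = "pres_S n r i"
      and ?R' = "inv\<^bsub>F\<^esub> pres_a n i \<otimes>\<^bsub>F\<^esub> pres_R n i \<otimes>\<^bsub>F\<^esub> pres_a n i"
    have R': "?R' \<in> N" using conj_closed[OF N RS(1)[OF i] ab(1)[OF i]] .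
    have "D i \<triangleleft>\<^bsub>M\<^esub> (\<one>\<^bsub>ZG\<^esub> \<ominus>\<^bsub>ZG\<^esub> a i) = D i \<ominus>\<^bsub>M\<^esub> D i \<triangleleft>\<^bsub>M\<^esub> a i"
      by (rule M.rsmult_one_minus) (use i D a in auto)
    also have "D i \<triangleleft>\<^bsub>M\<^esub> a i = ?c ?R'"
      using relation_module_coset_act[OF N RS(1)[OF i] ab(1)[OF i]]
      by (simp add: D_def pres_D_def a_def pres_aZ_def M_eq F_def N_def)
    also have "D i \<ominus>\<^bsub>M\<^esub> ?c ?R' = ?c (?R \<otimes>\<^bsub>F\<^esub> inv\<^bsub>F\<^esub> ?R')"
      using relation_module_coset_diff[OF N RS(1)[OF i] R']
      by (simp add: D_def pres_D_def M_eq F_def N_def)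
    finally have "Xs i = ?c ?S \<oplus>\<^bsub>M\<^esub> ?c (?R \<otimes>\<^bsub>F\<^esub> inv\<^bsub>F\<^esub> ?R')"
      using i by (simp add: Xs_def E_def pres_E_def F_def N_def)
    also have "\<dots> = ?c (?S \<otimes>\<^bsub>F\<^esub> (?R \<otimes>\<^bsub>F\<^esub> inv\<^bsub>F\<^esub> ?R'))"
      using h.hom_mult[of ?S "?R \<otimes>\<^bsub>F\<^esub> inv\<^bsub>F\<^esub> ?R'"] RS[OF i] R' by simp
    also have "?S \<otimes>\<^bsub>F\<^esub> (?R \<otimes>\<^bsub>F\<^esub> inv\<^bsub>F\<^esub> ?R') = ?S \<otimes>\<^bsub>F\<^esub> ?R \<otimes>\<^bsub>F\<^esub> inv\<^bsub>F\<^esub> ?R'"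
      by (intro N.m_assoc[symmetric] N.inv_closed N.mem_carrier RS[OF i] R')
    finally show ?thesis .
  qed
  have "carrier M \<subseteq> H" if H: "right_submodule H ZG M" and X: "Xs ` {1..n+1} \<subseteq> H" for H
  proof -
    let ?K = "submodule_preimage F N H"
    note H' = H[unfolded ZG_eq M_eq]
    interpret K: normal ?K F by (rule submodule_preimage_normal[OF N H'])
    have subH: "subgroup H (add_monoid M)" using H by (simp add: right_submodule_def)
    have torsion: "pres_R n i [^]\<^bsub>F\<^esub> (r i)\<^sup>2 \<in> ?K"
      and S_mem: "pres_R n i \<in> ?K \<Longrightarrow> pres_S n r i \<in> ?K" if i: "i \<in> {1..n}" for i
    proof -
      let ?x = "pres_S n r i \<otimes>\<^bsub>F\<^esub> pres_R n i \<otimes>\<^bsub>F\<^esub>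
          inv\<^bsub>F\<^esub> (inv\<^bsub>F\<^esub> pres_a n i \<otimes>\<^bsub>F\<^esub> pres_R n i \<otimes>\<^bsub>F\<^esub> pres_a n i)"
      have "?x \<in> N"
        using RS[OF i] conj_closed[OF N RS(1)[OF i] ab(1)[OF i]] by simp
      moreover have "Xs i \<in> H" using X i by auto
      ultimately have "?x \<in> ?K"
        using Xs_first[OF i] by (simp add: submodule_preimage_def)
      note twist = twisted_commutator_torsion_mod_submodule[OF N H' ab[OF i]
          pres_R_def[of n i, folded F_def] pres_S_def[of n r i, folded F_def] RS[OF i] this]
      show "pres_R n i [^]\<^bsub>F\<^esub> (r i)\<^sup>2 \<in> ?K" by (rule twist(1))
      show "pres_R n i \<in> ?K \<Longrightarrow> pres_S n r i \<in> ?K" by (rule twist(2))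
    qed
    have D_mem: "D j \<in> H" if j: "j \<in> {1..n}" for j
    proof (rule comm_group.coprime_torsion_factors_mem_subgroup[OF M.a_comm_group subH
          finite_atLeastAtMost _ _ _ _ j])
      show "D \<in> {1..n} \<rightarrow> carrier (add_monoid M)" using D by auto
      show "finprod (add_monoid M) D {1..n} \<in> H"
      proof -
        have "Xs (n + 1) \<in> H" using X by auto
        then show ?thesis by (simp add: Xs_def finsum_def)
      qed
      show "coprime ((r i)\<^sup>2) ((r k)\<^sup>2)" if "i \<in> {1..n}" "k \<in> {1..n}" "i \<noteq> k" for i k
        using assms(3) that by simp
      show "D i [^]\<^bsub>add_monoid M\<^esub> (r i)\<^sup>2 \<in> H" if i: "i \<in> {1..n}" for i
        using torsion[OF i] relation_module_coset_pow[OF N RS(1)[OF i], of "(r i)\<^sup>2"]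
        by (simp add: submodule_preimage_def add_pow_def D_def pres_D_def M_eq F_def N_def)
    qed
    have "pres_R n i \<in> ?K" if "i \<in> {1..n}" for i
      using D_mem[OF that] RS(1)[OF that]
      by (simp add: submodule_preimage_def D_def pres_D_def F_def N_def)
    then have "pres_R n ` {1..n} \<union> pres_S n r ` {1..n} \<subseteq> ?K"
      using S_mem by auto
    then have "pres_N n r \<subseteq> ?K"
      unfolding pres_N_def normal_closure_def
      by (intro Inter_lower) (simp add: K.normal_axioms flip: F_def)
    then have "N \<subseteq> ?K" by (simp add: N_def)
    then show ?thesis
      by (auto simp: M_eq relation_module_simps carrier_relation_group submodule_preimage_def)
  qed
  moreover have "right_submodule (carrier M) ZG M"
    using group.subgroup_self[OF M.a_group] by (simp add: right_submodule_def M.rsmult_closed)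
  moreover have "Xs ` {1..n+1} \<subseteq> carrier M"
  proof -
    have "Xs i \<in> carrier M" if "i \<in> {1..n+1}" for i
      using that D E a
      by (auto simp: Xs_def intro!: M.rsmult_closed M.finsum_closed)
    then show ?thesis by blast
  qed
  ultimately have "right_span ZG M (Xs ` {1..n+1}) = carrier M"
    unfolding right_span_def by blast
  then show ?thesis
    unfolding Xs_def M_def ZG_def D_def E_def a_def Let_def .
qed

end
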